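(* For every integer $n\geq 3$, the graph $G = K_n\cdot K_n$, which has order $2n$, is $L$-borderenergetic and is $L$-noncospectral with the complete graph $K_{2n}$.
   Context: All graphs are finite, undirected, without loops or multiple edges. $K_m$ is the complete graph on $m$ vertices. For $n\geq 3$, $K_n\cdot K_n$ is the graph of order $2n$ obtained from two disjoint copies of $K_n$ by adding $n$ edges joining one fixed vertex of one copy to all $n$ vertices of the other copy. The Laplacian matrix is $L=D-A$ (diagonal degree matrix minus adjacency matrix). For a graph $G$ of order $N$ with Laplacian eigenvalues $\mu_1,\dots,\mu_N$ (with multiplicity) and average degree $\overline{d}$, the Laplacian energy is $E_L(G)=\sum_{i=1}^N|\mu_i-\overline{d}|$. A graph $G$ of order $N$ is $L$-borderenergetic if $E_L(G)=2N-2$ (which is the Laplacian energy of $K_N$). Two graphs are $L$-noncospectral if their Laplacian spectra (as multisets) are different. *)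

theory Defs
  imports
    "Graph_Theory.Graph_Theory"
    "Jordan_Normal_Form.Char_Poly"
    "HOL-Combinatorics.List_Permutation"
begin

text \<open>
  A finite simple graph is a \<open>pair_pre_digraph\<close> \<open>G\<close> with \<open>pair_graph G\<close>: finitely many vertices,
  a symmetric arc relation and no loops. An undirected edge \<open>uv\<close> is the pair of arcs \<open>(u,v)\<close>,
  \<open>(v,u)\<close>, so the degree of a vertex is its out-degree. The library predicate \<open>K\<^bsub>m\<^esub> G\<close> says that
  \<open>G\<close> is a complete graph on \<open>m\<close> vertices.
\<close>

definition dot_complete :: "nat \<Rightarrow> 'a pair_pre_digraph \<Rightarrow> bool" where
  "dot_complete n G \<longleftrightarrow>
     (\<exists>H\<^sub>1 H\<^sub>2 :: 'a pair_pre_digraph. \<exists>v.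
        K\<^bsub>n\<^esub> (with_proj H\<^sub>1) \<and> K\<^bsub>n\<^esub> (with_proj H\<^sub>2) \<and> pverts H\<^sub>1 \<inter> pverts H\<^sub>2 = {} \<and> v \<in> pverts H\<^sub>1 \<and>
        pverts G = pverts H\<^sub>1 \<union> pverts H\<^sub>2 \<and>
        parcs G = parcs H\<^sub>1 \<union> parcs H\<^sub>2 \<union> {v} \<times> pverts H\<^sub>2 \<union> pverts H\<^sub>2 \<times> {v})"

definition degree_matrix :: "'a pair_pre_digraph \<Rightarrow> 'a list \<Rightarrow> real mat" where
  "degree_matrix G vs = mat (length vs) (length vs)
     (\<lambda>(i, j). if i = j then real (out_degree (with_proj G) (vs ! i)) else 0)"

definition adjacency_matrix :: "'a pair_pre_digraph \<Rightarrow> 'a list \<Rightarrow> real mat" where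
  "adjacency_matrix G vs = mat (length vs) (length vs)
     (\<lambda>(i, j). if (vs ! i, vs ! j) \<in> parcs G then 1 else 0)"

definition laplacian_matrix :: "'a pair_pre_digraph \<Rightarrow> 'a list \<Rightarrow> real mat" where
  "laplacian_matrix G vs = degree_matrix G vs - adjacency_matrix G vs"

definition vertex_enum :: "'a pair_pre_digraph \<Rightarrow> 'a list" where
  "vertex_enum G = (SOME vs. distinct vs \<and> set vs = pverts G)"

text \<open>
  The Laplacian matrix is real symmetric, so all complex roots of its characteristic polynomial
  are real and the multiset of real roots is the full spectrum. The choice of the enumeration is
  immaterial, see \<open>laplacian_spectrum_eq\<close> below.
\<close>

definition laplacian_spectrum :: "'a pair_pre_digraph \<Rightarrow> real multiset" where
  "laplacian_spectrum G = proots (char_poly (laplacian_matrix G (vertex_enum G)))"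

definition average_degree :: "'a pair_pre_digraph \<Rightarrow> real" where
  "average_degree G =
     (\<Sum>v\<in>pverts G. real (out_degree (with_proj G) v)) / real (card (pverts G))"

definition laplacian_energy :: "'a pair_pre_digraph \<Rightarrow> real" where
  "laplacian_energy G = (\<Sum>\<mu>\<in>#laplacian_spectrum G. \<bar>\<mu> - average_degree G\<bar>)"

definition L_borderenergetic :: "'a pair_pre_digraph \<Rightarrow> bool" where
  "L_borderenergetic G \<longleftrightarrow> laplacian_energy G = 2 * real (card (pverts G)) - 2"

definition L_noncospectral :: "'a pair_pre_digraph \<Rightarrow> 'b pair_pre_digraph \<Rightarrow> bool" where
  "L_noncospectral G H \<longleftrightarrow> laplacian_spectrum G \<noteq> laplacian_spectrum H"

lemma dot_complete_exists:
  assumes "n \<ge> 1"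
  shows "\<exists>G :: nat pair_pre_digraph. dot_complete n G"
proof -
  define C :: "nat set \<Rightarrow> nat pair_pre_digraph"
    where "C A = \<lparr>pverts = A, parcs = {(u, v). u \<in> A \<and> v \<in> A \<and> u \<noteq> v}\<rparr>" for A
  have K: "K\<^bsub>n\<^esub> (with_proj (C A))" if "finite A" "card A = n" for A
    using that unfolding complete_digraph_pair_def by (auto simp: C_def)
  let ?H1 = "C {..<n}" and ?H2 = "C {n..<2 * n}"
  have "K\<^bsub>n\<^esub> (with_proj ?H1)" "K\<^bsub>n\<^esub> (with_proj ?H2)"
    by (auto intro!: K)
  moreover have "pverts ?H1 \<inter> pverts ?H2 = {}" "0 \<in> pverts ?H1"
    using assms by (auto simp: C_def)
  ultimately have "dot_complete n \<lparr>pverts = pverts ?H1 \<union> pverts ?H2,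
      parcs = parcs ?H1 \<union> parcs ?H2 \<union> {0} \<times> pverts ?H2 \<union> pverts ?H2 \<times> {0}\<rparr>"
    unfolding dot_complete_def
    by (intro exI[of _ ?H1] exI[of _ ?H2] exI[of _ 0]) simp
  then show ?thesis ..
qed

lemma char_poly_laplacian_matrix_perm:
  assumes "distinct vs" "distinct ws" "set vs = set ws"
  shows "char_poly (laplacian_matrix G vs) = char_poly (laplacian_matrix G ws)"
proof -
  define n where "n = length vs"
  have lw: "length ws = n"
    using assms distinct_card[of vs] distinct_card[of ws] by (simp add: n_def)
  have "mset vs = mset ws"
    using assms by (simp add: set_eq_iff_mset_eq_distinct)
  then obtain p where p: "p permutes {..<n}" and pl: "permute_list p ws = vs"
    using lw mset_eq_permutation[of vs ws] by auto
  have pv: "vs ! i = ws ! p i" if "i < n" for i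
    using permute_list_nth[of p ws i] p pl lw that by simp
  have plt: "p i < n \<longleftrightarrow> i < n" for i
    using permutes_in_image[OF p] by simp
  have pinj: "p i = p j \<longleftrightarrow> i = j" for i j
    using permutes_inj[OF p] by (auto dest: injD)
  have L: "laplacian_matrix G xs \<in> carrier_mat (length xs) (length xs)" for xs
    unfolding laplacian_matrix_def degree_matrix_def adjacency_matrix_def
    by (intro minus_carrier_mat mat_carrier)
  have Lij: "char_poly_matrix (laplacian_matrix G xs) $$ (i, j) =
      (if i = j then [:- real (out_degree (with_proj G) (xs ! i)), 1:] else 0) +
      (if (xs ! i, xs ! j) \<in> parcs G then 1 else 0)"
    if "i < length xs" "j < length xs" for xs i j
    unfolding char_poly_matrix_def laplacian_matrix_def degree_matrix_def adjacency_matrix_def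
    using that by (simp add: one_pCons)
  define A where "A = char_poly_matrix (laplacian_matrix G ws)"
  have A: "A \<in> carrier_mat n n"
    unfolding A_def using L[of ws] lw by simp
  define B where "B = mat n n (\<lambda>(i, j). A $$ (p i, j))"
  have B: "B \<in> carrier_mat n n"
    by (simp add: B_def)
  have p': "p permutes {0..<n}"
    using p by (simp add: atLeast0LessThan)
  have eq: "char_poly_matrix (laplacian_matrix G vs) =
      transpose_mat (mat n n (\<lambda>(i, j). transpose_mat B $$ (p i, j)))"
  proof (rule eq_matI, goal_cases)
    case (1 i j)
    then have ij: "i < n" "j < n" by simp_all
    then have pij: "p i < n" "p j < n" by (simp_all add: plt)
    have "transpose_mat (mat n n (\<lambda>(i, j). transpose_mat B $$ (p i, j))) $$ (i, j) =
        A $$ (p i, p j)"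
      using ij pij by (simp add: B_def)
    then show ?case
      using ij pij by (simp add: A_def Lij lw n_def[symmetric] pv pinj)
  qed (use L[of vs] in \<open>simp_all add: n_def char_poly_matrix_def\<close>)
  have "det (char_poly_matrix (laplacian_matrix G vs)) =
      det (mat n n (\<lambda>(i, j). transpose_mat B $$ (p i, j)))"
    unfolding eq by (rule det_transpose[OF mat_carrier])
  also have "\<dots> = signof p * det (transpose_mat B)"
    using B p' by (intro det_permute_rows) auto
  also have "det (transpose_mat B) = det B"
    using B by (rule det_transpose)
  also have "det B = signof p * det A"
    unfolding B_def using A p' by (rule det_permute_rows)
  also have "signof p * (signof p * det A) = det A"
    by (simp add: sign_def)
  finally show ?thesis
    by (simp add: char_poly_def A_def)
qed

lemma laplacian_spectrum_eq:
  assumes "distinct vs" "set vs = pverts G"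
  shows "laplacian_spectrum G = proots (char_poly (laplacian_matrix G vs))"
proof -
  have "distinct (vertex_enum G) \<and> set (vertex_enum G) = pverts G"
    unfolding vertex_enum_def by (rule someI[of _ vs]) (use assms in auto)
  then show ?thesis
    using assms char_poly_laplacian_matrix_perm[of "vertex_enum G" vs G]
    by (simp add: laplacian_spectrum_def)
qed

end

theory Submission
  imports Defs
begin

text \<open>
  Let \<open>v\<close> be the vertex joined to the second clique \<open>W\<close>, and \<open>U\<close> the other \<open>n - 1\<close> vertices of the
  first clique. Then \<open>G\<close> is the cone with apex \<open>v\<close> over the disjoint union of the cliques \<open>U\<close> and
  \<open>W\<close>, and its Laplacian spectrum is
  \<open>0\<close>, \<open>2n\<close>, \<open>1\<close>, \<open>n\<close> (\<open>n - 2\<close> times) and \<open>n + 1\<close> (\<open>n - 1\<close> times).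
  The degrees are \<open>n - 1\<close> on \<open>U\<close>, \<open>n\<close> on \<open>W\<close> and \<open>2n - 1\<close> at \<open>v\<close>, so the average degree is \<open>n\<close>.
  The energy is therefore \<open>n + n + (n - 1) + 0 + (n - 1) = 4n - 2\<close>, as for \<open>K\<^sub>2\<^sub>n\<close>. The spectrum of
  \<open>K\<^sub>2\<^sub>n\<close> contains only \<open>0\<close> and \<open>2n\<close>, hence not the eigenvalue \<open>1\<close> of \<open>G\<close>.

  For the spectrum, multiplicities included, the Laplacian is brought to triangular form instead of
  being diagonalised. An eigenbasis would need differences of indicator functions, whereas a
  triangular form only asks for an increasing chain of invariant subspaces, and indicator functions
  suffice for that: modulo the constants, \<open>\<delta>\<^sub>v\<close> and the indicator of \<open>U\<close>, every \<open>\<delta>\<^sub>x\<close> is already an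
  eigenvector, because the Laplacian of a clique is a multiple of the identity up to the all-ones
  matrix. Adapted to a suitable order of the vertices, such a basis is also a triangular matrix with
  nonzero diagonal, so that it is visibly a basis. This is \<open>laplacian_spectrum_triangular\<close>; it gives
  \<open>laplacian_spectrum_complete\<close> and \<open>laplacian_spectrum_G\<close>.
\<close>

section \<open>Spectra from triangularising bases\<close>

lemma char_poly_conjugate_upper_triangular:
  fixes A P T :: "'a :: field mat"
  assumes A: "A \<in> carrier_mat N N" and P: "P \<in> carrier_mat N N" and T: "T \<in> carrier_mat N N"
    and det: "det P \<noteq> 0" and eq: "A * P = P * T" and tri: "upper_triangular T"
  shows "char_poly A = (\<Prod>a\<leftarrow>diag_mat T. [:- a, 1:])"
proof -
  have "P \<in> Units (ring_mat TYPE('a) N ())"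
    by (rule det_non_zero_imp_unit[OF P det])
  then obtain Q where Q: "Q \<in> carrier_mat N N" "P * Q = 1\<^sub>m N" "Q * P = 1\<^sub>m N"
    by (auto simp: Units_def ring_mat_simps)
  have "A = A * (P * Q)"
    using A Q by simp
  also have "\<dots> = P * T * Q"
    unfolding eq[symmetric] using A P Q(1) by (rule assoc_mult_mat[symmetric])
  finally have "similar_mat A T"
    using A P T Q by (intro similar_matI[of A T P Q N]) auto
  then show ?thesis
    using char_poly_similar char_poly_upper_triangular[OF T tri] by metis
qed

lemma proots_prod_list_linear_factors:
  "proots (\<Prod>a\<leftarrow>xs. [:- a, 1 :: 'a :: idom:]) = mset xs"
proof (induction xs)
  case (Cons a xs)
  have "(\<Prod>a\<leftarrow>xs. [:- a, 1 :: 'a:]) \<noteq> 0"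
    by (auto simp: prod_list_zero_iff)
  then have "proots (\<Prod>a\<leftarrow>a # xs. [:- a, 1:]) = proots [:- a, 1:] + proots (\<Prod>a\<leftarrow>xs. [:- a, 1:])"
    by (simp only: list.map prod_list.Cons) (rule proots_mult; simp)
  with Cons show ?case
    by simp
qed simp

text \<open>
  The Laplacian as an operator on functions on the vertices, free of any enumeration. A term with
  \<open>f x = f y\<close> vanishes, so summing over a whole clique or over the clique without \<open>x\<close> is the same.
\<close>
definition laplacian_op :: "'a pair_pre_digraph \<Rightarrow> ('a \<Rightarrow> real) \<Rightarrow> 'a \<Rightarrow> real" where
  "laplacian_op G f x = (\<Sum>y | (x, y) \<in> parcs G. f x - f y)"

lemma out_degree_with_proj: "out_degree (with_proj G) x = card {y. (x, y) \<in> parcs G}"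
proof -
  have "out_arcs (with_proj G) x = Pair x ` {y. (x, y) \<in> parcs G}"
    by (auto simp: out_arcs_def)
  then show ?thesis
    by (simp add: out_degree_def card_image inj_on_def)
qed

lemma laplacian_matrix_carrier:
  "laplacian_matrix G vs \<in> carrier_mat (length vs) (length vs)"
  unfolding laplacian_matrix_def degree_matrix_def adjacency_matrix_def
  by (intro minus_carrier_mat mat_carrier)

lemma laplacian_matrix_row_sum:
  assumes "pair_graph G" "distinct vs" "set vs = pverts G" "i < length vs"
  shows "(\<Sum>k<length vs. laplacian_matrix G vs $$ (i, k) * f (vs ! k)) = laplacian_op G f (vs ! i)"
proof -
  interpret pair_graph G by fact
  let ?x = "vs ! i" and ?N = "{y. (vs ! i, y) \<in> parcs G}"
  have fin: "finite ?N"
    by (rule finite_subset[OF _ pair_finite_verts]) (auto dest: in_arcsD2)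
  have sub: "?N \<subseteq> set vs"
    using assms by (auto dest: in_arcsD2)
  have "(\<Sum>k<length vs. laplacian_matrix G vs $$ (i, k) * f (vs ! k)) =
      (\<Sum>k<length vs. (if k = i then real (card ?N) * f ?x else 0) -
        (if vs ! k \<in> ?N then f (vs ! k) else 0))"
    using assms(4) by (intro sum.cong)
      (auto simp: laplacian_matrix_def degree_matrix_def adjacency_matrix_def out_degree_with_proj
        left_diff_distrib)
  also have "\<dots> = real (card ?N) * f ?x - (\<Sum>k<length vs. if vs ! k \<in> ?N then f (vs ! k) else 0)"
    using assms(4) by (simp add: sum_subtractf)
  also have "(\<Sum>k<length vs. if vs ! k \<in> ?N then f (vs ! k) else 0) =
      (\<Sum>y\<in>set vs. if y \<in> ?N then f y else 0)"
    by (rule sum.reindex_bij_betw[OF bij_betw_nth[OF assms(2) refl refl],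
        where g = "\<lambda>y. if y \<in> ?N then f y else 0"])
  also have "\<dots> = (\<Sum>y\<in>?N. f y)"
    using sub by (simp add: sum.If_cases Int_absorb1)
  finally show ?thesis
    by (simp add: laplacian_op_def sum_subtractf)
qed

text \<open>
  The functions \<open>b j\<close> are the columns of a matrix \<open>P\<close>. It is lower triangular with nonzero diagonal,
  hence invertible, and the Laplacian matrix satisfies \<open>L P = P T\<close> with \<open>T\<close> upper triangular: \<open>T\<close>
  has \<open>l\<close> on its diagonal and \<open>c\<close> above it. The corrections \<open>c\<close> are confined to the first \<open>r\<close> basis
  functions, so that in applications the sum has a fixed small number of terms.
\<close>
lemma laplacian_spectrum_triangular:
  assumes G: "pair_graph G" and vs: "distinct vs" "set vs = pverts G"
    and low: "\<And>i j. i < j \<Longrightarrow> j < length vs \<Longrightarrow> b j (vs ! i) = 0"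
    and diag: "\<And>j. j < length vs \<Longrightarrow> b j (vs ! j) \<noteq> 0"
    and r: "r \<le> length vs" and upp: "\<And>k j. j \<le> k \<Longrightarrow> c k j = 0"
    and eq: "\<And>j x. j < length vs \<Longrightarrow> x \<in> pverts G \<Longrightarrow>
      laplacian_op G (b j) x = l j * b j x + (\<Sum>k<r. c k j * b k x)"
  shows "laplacian_spectrum G = mset (map l [0..<length vs])"
proof -
  define N where "N = length vs"
  define P where "P = mat N N (\<lambda>(i, j). b j (vs ! i))"
  define t where "t k j = (if k = j then l j else 0) + (if k < r then c k j else 0)" for k j
  define T where "T = mat N N (\<lambda>(k, j). t k j)"
  let ?L = "laplacian_matrix G vs"
  have carrier: "?L \<in> carrier_mat N N" "P \<in> carrier_mat N N" "T \<in> carrier_mat N N"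
    using laplacian_matrix_carrier[of G vs] by (simp_all add: N_def P_def T_def)
  have "det P = prod_list (diag_mat P)"
    by (rule det_lower_triangular[OF _ carrier(2)]) (simp add: P_def low N_def)
  also have "\<dots> \<noteq> 0"
    by (auto simp: prod_list_zero_iff diag_mat_def P_def N_def diag)
  finally have "det P \<noteq> 0" .
  moreover have "?L * P = P * T"
  proof (rule eq_matI, goal_cases)
    case (1 i j)
    then have ij: "i < N" "j < N"
      using carrier by auto
    let ?x = "vs ! i"
    have "(?L * P) $$ (i, j) = (\<Sum>k<N. ?L $$ (i, k) * b j (vs ! k))"
      using carrier ij by (simp add: times_mat_def scalar_prod_def P_def atLeast0LessThan)
    also have "\<dots> = laplacian_op G (b j) ?x"
      using laplacian_matrix_row_sum[OF G vs, of i "b j"] ij by (simp add: N_def)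
    also have "\<dots> = l j * b j ?x + (\<Sum>k<r. c k j * b k ?x)"
      using eq[of j ?x] ij vs(2) nth_mem[of i vs] by (simp add: N_def)
    also have "(\<Sum>k<r. c k j * b k ?x) = (\<Sum>k<N. if k < r then c k j * b k ?x else 0)"
      using r by (intro sum.mono_neutral_cong_left) (auto simp: N_def)
    also have "l j * b j ?x = (\<Sum>k<N. if k = j then l j * b j ?x else 0)"
      using ij by simp
    also have "\<dots> + (\<Sum>k<N. if k < r then c k j * b k ?x else 0) = (\<Sum>k<N. b k ?x * t k j)"
      unfolding sum.distrib[symmetric] by (intro sum.cong) (auto simp: t_def algebra_simps)
    also have "\<dots> = (P * T) $$ (i, j)"
      using carrier ij by (simp add: times_mat_def scalar_prod_def P_def T_def atLeast0LessThan)
    finally show ?case .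
  qed (use carrier in auto)
  moreover have "upper_triangular T"
    by (auto simp: upper_triangular_def T_def t_def upp)
  ultimately have "char_poly ?L = (\<Prod>a\<leftarrow>diag_mat T. [:- a, 1:])"
    using carrier by (intro char_poly_conjugate_upper_triangular)
  moreover have "diag_mat T = map l [0..<N]"
    by (simp add: diag_mat_def T_def t_def upp)
  ultimately show ?thesis
    by (simp only: laplacian_spectrum_eq[OF vs] proots_prod_list_linear_factors N_def)
qed

section \<open>The complete graph\<close>

text \<open>
  The basis consists of the constant function, placed at the first vertex, and of \<open>\<delta>\<^sub>x\<close> for every
  other vertex \<open>x\<close>. The constant is in the kernel, and the Laplacian maps \<open>\<delta>\<^sub>x\<close> to \<open>m \<delta>\<^sub>x - 1\<close>.
\<close>
lemma laplacian_spectrum_complete: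
  assumes "K\<^bsub>m\<^esub> (with_proj H)" "m \<ge> 1"
  shows "laplacian_spectrum H = add_mset 0 (replicate_mset (m - 1) (real m))"
proof -
  have G: "pair_graph H"
    using assms(1) by (simp add: complete_digraph_def pair_graphI_graph)
  have H: "finite (pverts H)" "card (pverts H) = m"
    "parcs H = {(u, v). (u, v) \<in> pverts H \<times> pverts H \<and> u \<noteq> v}"
    using assms(1) by (simp_all add: complete_digraph_pair_def)
  obtain vs where vs: "distinct vs" "set vs = pverts H"
    using finite_distinct_list[OF H(1)] by blast
  have len: "length vs = m"
    using vs H distinct_card[of vs] by simp
  have inj: "vs ! i = vs ! j \<longleftrightarrow> i = j" if "i < m" "j < m" for i j
    using that vs len by (simp add: nth_eq_iff_index_eq)
  have mem: "vs ! i \<in> pverts H" if "i < m" for i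
    using that vs len nth_mem by metis
  have lap: "laplacian_op H f x = real m * f x - sum f (pverts H)" if "x \<in> pverts H" for f x
  proof -
    have "laplacian_op H f x = (\<Sum>y\<in>pverts H - {x}. f x - f y)"
      using that unfolding laplacian_op_def H(3) by (intro sum.cong) auto
    also have "\<dots> = (\<Sum>y\<in>pverts H. f x - f y)"
      using that H(1) by (simp add: sum_diff1)
    finally show ?thesis
      by (simp add: sum_subtractf H(2))
  qed
  define b where "b j x = (if j = 0 then 1 else of_bool (x = vs ! j) :: real)" for j x
  define l where "l j = (if j = 0 then 0 else real m)" for j :: nat
  define c where "c k j = (if k = 0 \<and> j \<noteq> 0 then - 1 else 0 :: real)" for k j :: nat
  have "laplacian_spectrum H = mset (map l [0..<length vs])"
  proof (rule laplacian_spectrum_triangular[OF G vs, where b = b and r = 1 and c = c])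
    fix j x assume j: "j < length vs" "x \<in> pverts H"
    show "laplacian_op H (b j) x = l j * b j x + (\<Sum>k<1. c k j * b k x)"
      using j mem[of j] H(1,2) by (simp add: lap b_def l_def c_def len of_bool_def)
  qed (use assms(2) inj in \<open>auto simp: b_def c_def len\<close>)
  also have "map l [0..<length vs] = 0 # replicate (m - 1) (real m)"
    by (rule nth_equalityI) (use assms(2) in \<open>auto simp: len l_def nth_Cons'\<close>)
  finally show ?thesis
    by simp
qed

section \<open>The cone over two disjoint cliques\<close>

text \<open>
  Here \<open>v\<close> is separated from the first copy of \<open>K\<^sub>n\<close>, so that the three cells \<open>U\<close>, \<open>W\<close> and \<open>{v}\<close>
  are the sets on which the degree is constant.
\<close>
locale dot_complete_graph =
  fixes n :: nat and G :: "'a pair_pre_digraph" and U W :: "'a set" and v :: 'a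
  assumes n: "n \<ge> 3"
    and fin: "finite U" "finite W"
    and card_U: "card U = n - 1" and card_W: "card W = n"
    and disj: "U \<inter> W = {}" "v \<notin> U" "v \<notin> W"
    and verts: "pverts G = insert v (U \<union> W)"
    and arc_iff: "\<And>x y. (x, y) \<in> parcs G \<longleftrightarrow> x \<noteq> y \<and>
      (x \<in> U \<and> y \<in> U \<or> x \<in> W \<and> y \<in> W \<or> x = v \<and> y \<in> U \<union> W \<or> y = v \<and> x \<in> U \<union> W)"
begin

lemma pair_graph_G: "pair_graph G"
proof -
  have "parcs G \<subseteq> pverts G \<times> pverts G"
    by (auto simp: arc_iff verts)
  then have "finite (parcs G)"
    by (rule finite_subset) (simp add: verts fin)
  then show ?thesis
    by unfold_locales (auto simp: arc_iff verts fin symmetric_def intro!: symI)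
qed

lemma neighbours:
  "x \<in> U \<Longrightarrow> {y. (x, y) \<in> parcs G} = insert v (U - {x})"
  "x \<in> W \<Longrightarrow> {y. (x, y) \<in> parcs G} = insert v (W - {x})"
  "{y. (v, y) \<in> parcs G} = U \<union> W"
  using disj by (auto simp: arc_iff)

lemma card_verts: "card (pverts G) = 2 * n"
  using n fin disj by (simp add: verts card_U card_W card_Un_disjoint)

lemma sum_verts: "sum f (pverts G) = f v + sum f U + (sum f W :: real)"
  using fin disj by (simp add: verts sum.union_disjoint)

lemma out_degrees:
  "x \<in> U \<Longrightarrow> out_degree (with_proj G) x = n - 1"
  "x \<in> W \<Longrightarrow> out_degree (with_proj G) x = n"
  "out_degree (with_proj G) v = 2 * n - 1"
proof -
  show "out_degree (with_proj G) x = n - 1" if "x \<in> U"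
  proof -
    have "card U = Suc (card (U - {x}))"
      using that fin(1) by (rule card.remove[rotated])
    moreover have "card (insert v (U - {x})) = Suc (card (U - {x}))"
      using fin(1) disj(2) by simp
    ultimately show ?thesis
      using that by (simp only: out_degree_with_proj neighbours card_U)
  qed
  show "out_degree (with_proj G) x = n" if "x \<in> W"
  proof -
    have "card W = Suc (card (W - {x}))"
      using that fin(2) by (rule card.remove[rotated])
    moreover have "card (insert v (W - {x})) = Suc (card (W - {x}))"
      using fin(2) disj(3) by simp
    ultimately show ?thesis
      using that by (simp only: out_degree_with_proj neighbours card_W)
  qed
  show "out_degree (with_proj G) v = 2 * n - 1"
    using n fin disj(1)
    by (simp add: out_degree_with_proj neighbours card_Un_disjoint card_U card_W)
qed

lemma average_degree_G: "average_degree G = real n"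
proof -
  have "(\<Sum>x\<in>pverts G. real (out_degree (with_proj G) x)) =
      real (2 * n - 1) + real (n - 1) * real (n - 1) + real n * real n"
    by (simp add: sum_verts out_degrees card_U card_W)
  also have "\<dots> = 2 * real n * real n"
    using n by (simp add: of_nat_diff algebra_simps)
  finally show ?thesis
    using n by (simp add: average_degree_def card_verts)
qed

lemma laplacian_op_G:
  "x \<in> U \<Longrightarrow> laplacian_op G f x = real n * f x - f v - sum f U"
  "x \<in> W \<Longrightarrow> laplacian_op G f x = (real n + 1) * f x - f v - sum f W"
  "laplacian_op G f v = (2 * real n - 1) * f v - sum f U - sum f W"
proof -
  have clique: "(\<Sum>y\<in>insert v (S - {x}). f x - f y) = (real (card S) + 1) * f x - f v - sum f S"
    if "x \<in> S" "finite S" "v \<notin> S" for S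
  proof -
    have "(\<Sum>y\<in>insert v (S - {x}). f x - f y) = f x - f v + (\<Sum>y\<in>S. f x - f y)"
      using that by (simp add: sum_diff1)
    then show ?thesis
      by (simp add: sum_subtractf algebra_simps)
  qed
  show "laplacian_op G f x = real n * f x - f v - sum f U" if "x \<in> U"
    using clique[OF that] that n fin disj
    by (simp add: laplacian_op_def neighbours card_U of_nat_diff)
  show "laplacian_op G f x = (real n + 1) * f x - f v - sum f W" if "x \<in> W"
    using clique[OF that] that fin disj by (simp add: laplacian_op_def neighbours card_W)
  show "laplacian_op G f v = (2 * real n - 1) * f v - sum f U - sum f W"
    using n fin disj
    by (simp add: laplacian_op_def neighbours sum.union_disjoint sum_subtractf card_Un_disjoint
        card_U card_W of_nat_diff algebra_simps)
qed

text \<open>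
  The images of the five kinds of basis functions. Each is a multiple of the function itself plus
  constants, \<open>\<delta>\<^sub>v\<close> and the indicator of \<open>U\<close>; in the last one the indicator of \<open>W\<close> has been
  eliminated, being the constant \<open>1\<close> minus \<open>\<delta>\<^sub>v\<close> and the indicator of \<open>U\<close>.
\<close>
lemma laplacian_op_flag:
  assumes "x \<in> pverts G"
  shows "laplacian_op G (\<lambda>_. 1) x = 0"
    and "laplacian_op G (\<lambda>y. of_bool (y = v)) x = 2 * real n * of_bool (x = v) - 1"
    and "laplacian_op G (\<lambda>y. of_bool (y \<in> U)) x =
      of_bool (x \<in> U) - (real n - 1) * of_bool (x = v)"
    and "u \<in> U \<Longrightarrow> laplacian_op G (\<lambda>y. of_bool (y = u)) x =
      real n * of_bool (x = u) - of_bool (x = v) - of_bool (x \<in> U)"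
    and "w \<in> W \<Longrightarrow> laplacian_op G (\<lambda>y. of_bool (y = w)) x =
      (real n + 1) * of_bool (x = w) - 1 + of_bool (x \<in> U)"
proof -
  have sum0: "(\<Sum>y\<in>S. of_bool (y = a)) = (of_bool (a \<in> S) :: real)" if "finite S" for S and a :: 'a
    using that by (simp add: of_bool_def)
  have sumU: "(\<Sum>y\<in>U. of_bool (y \<in> U)) = real n - 1" "(\<Sum>y\<in>W. of_bool (y \<in> U)) = (0 :: real)"
    using n disj by (auto simp: card_U of_nat_diff intro!: sum.neutral)
  consider "x \<in> U" | "x \<in> W" | "x = v"
    using assms by (auto simp: verts)
  note cases = this
  have real_card: "real (card U) = real n - 1" "real (card W) = real n"
    using n by (simp_all add: card_U card_W of_nat_diff)
  note facts = laplacian_op_G sum0 sumU fin real_card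
  show "laplacian_op G (\<lambda>_. 1) x = 0"
    by (rule cases) (auto simp: facts)
  show "laplacian_op G (\<lambda>y. of_bool (y = v)) x = 2 * real n * of_bool (x = v) - 1"
    by (rule cases) (use disj in \<open>auto simp: facts\<close>)
  show "laplacian_op G (\<lambda>y. of_bool (y \<in> U)) x = of_bool (x \<in> U) - (real n - 1) * of_bool (x = v)"
    by (rule cases) (use disj in \<open>auto simp: facts\<close>)
  show "laplacian_op G (\<lambda>y. of_bool (y = u)) x =
      real n * of_bool (x = u) - of_bool (x = v) - of_bool (x \<in> U)" if "u \<in> U"
    by (rule cases) (use disj that in \<open>auto simp: facts\<close>)
  show "laplacian_op G (\<lambda>y. of_bool (y = w)) x =
      (real n + 1) * of_bool (x = w) - 1 + of_bool (x \<in> U)" if "w \<in> W"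
    by (rule cases) (use disj that in \<open>auto simp: facts\<close>)
qed

lemma laplacian_spectrum_G:
  "laplacian_spectrum G =
     {#0, 2 * real n, 1#} + replicate_mset (n - 2) (real n) + replicate_mset (n - 1) (real n + 1)"
proof -
  have "U \<noteq> {}" "W \<noteq> {}"
    using n card_U card_W by auto
  then obtain u0 w0 where u0: "u0 \<in> U" and w0: "w0 \<in> W"
    by blast
  obtain us where us: "distinct us" "set us = U - {u0}"
    using finite_distinct_list[of "U - {u0}"] fin by blast
  obtain ws where ws: "distinct ws" "set ws = W - {w0}"
    using finite_distinct_list[of "W - {w0}"] fin by blast
  have len_us: "length us = n - 2" and len_ws: "length ws = n - 1"
    using us ws u0 w0 distinct_card[of us] distinct_card[of ws] fin by (simp_all add: card_U card_W)
  \<comment> \<open>The chain of invariant subspaces starts with the constants, \<open>\<delta>\<^sub>v\<close> and the indicator of \<open>U\<close>.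
    For the triangular shape the vertices are listed so that \<open>w0\<close> stands for the constants (the
    only one of the three that is nonzero on \<open>W\<close>) and \<open>u0\<close> for the indicator of \<open>U\<close>, which
    vanishes at \<open>w0\<close> and \<open>v\<close>. The remaining vertices keep their own \<open>\<delta>\<^sub>x\<close>.\<close>
  define vs where "vs = w0 # v # u0 # us @ ws"
  have vs: "distinct vs" "set vs = pverts G"
    using us ws u0 w0 disj by (auto simp: vs_def verts)
  have len: "length vs = 2 * n"
    using n by (simp add: vs_def len_us len_ws)
  have inj: "vs ! i = vs ! j \<longleftrightarrow> i = j" if "i < 2 * n" "j < 2 * n" for i j
    using that vs len by (simp add: nth_eq_iff_index_eq)
  have vs012: "vs ! 0 = w0" "vs ! Suc 0 = v" "vs ! 2 = u0"
    by (simp_all add: vs_def)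
  have in_U: "vs ! j \<in> U" if "2 < j" "j \<le> n" for j
  proof -
    have "vs ! j = us ! (j - 3)" "j - 3 < length us"
      using that by (auto simp: vs_def nth_Cons' nth_append len_us numeral_3_eq_3)
    then show ?thesis
      using nth_mem us by fastforce
  qed
  have in_W: "vs ! j \<in> W" if "n < j" "j < 2 * n" for j
  proof -
    have "vs ! j = ws ! (j - 3 - (n - 2))" "j - 3 - (n - 2) < length ws"
      using that n by (auto simp: vs_def nth_Cons' nth_append len_us len_ws numeral_3_eq_3)
    then show ?thesis
      using nth_mem ws by fastforce
  qed
  define b :: "nat \<Rightarrow> 'a \<Rightarrow> real" where "b j =
    (if j = 0 then (\<lambda>_. 1) else if j = 2 then (\<lambda>x. of_bool (x \<in> U))
     else (\<lambda>x. of_bool (x = vs ! j)))" for j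
  define l where "l j =
    (if j = 0 then 0 else if j = 1 then 2 * real n else if j = 2 then 1
     else if j \<le> n then real n else real n + 1)" for j
  define c :: "nat \<Rightarrow> nat \<Rightarrow> real" where "c k j =
    (if j = 1 then (if k = 0 then - 1 else 0)
     else if j = 2 then (if k = 1 then - (real n - 1) else 0)
     else if 2 < j \<and> j \<le> n then (if k = 1 \<or> k = 2 then - 1 else 0)
     else if n < j then (if k = 0 then - 1 else if k = 2 then 1 else 0) else 0)" for k j
  have "laplacian_spectrum G = mset (map l [0..<length vs])"
  proof (rule laplacian_spectrum_triangular[OF pair_graph_G vs, where b = b and r = 3 and c = c])
    fix i j assume ij: "i < j" "j < length vs"
    show "b j (vs ! i) = 0"
    proof (cases "j = 2")
      case True
      with ij have "i = 0 \<or> i = Suc 0"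
        by auto
      with True w0 disj show ?thesis
        by (auto simp: b_def vs012)
    next
      case False
      with ij inj show ?thesis
        by (simp add: b_def len)
    qed
  next
    fix j assume j: "j < length vs"
    show "b j (vs ! j) \<noteq> 0"
      using u0 by (simp add: b_def vs012)
  next
    fix j x assume j: "j < length vs" and x: "x \<in> pverts G"
    have sum3: "(\<Sum>k<3. c k j * b k x) = c 0 j + c 1 j * of_bool (x = v) + c 2 j * of_bool (x \<in> U)"
    proof -
      have "{..<3 :: nat} = {0, 1, 2}"
        by auto
      then show ?thesis
        by (simp add: b_def vs012)
    qed
    consider "j = 0" | "j = 1" | "j = 2" | "2 < j" "j \<le> n" | "n < j"
      by linarith
    then show "laplacian_op G (b j) x = l j * b j x + (\<Sum>k<3. c k j * b k x)"
    proof cases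
      case 4
      with laplacian_op_flag(4)[OF x in_U[OF 4]] show ?thesis
        unfolding sum3 by (simp add: b_def l_def c_def)
    next
      case 5
      with laplacian_op_flag(5)[OF x in_W[of j]] j n show ?thesis
        unfolding sum3 by (simp add: b_def l_def c_def len)
    qed (unfold sum3, use n laplacian_op_flag(1-3)[OF x] in \<open>simp_all add: b_def l_def c_def vs012\<close>)
  qed (use n in \<open>auto simp: c_def len\<close>)
  also have "[0..<length vs] = [0, 1, 2] @ [3..<n + 1] @ [n + 1..<2 * n]"
  proof -
    have "[0..<3 + (2 * n - 3)] = [0..<3] @ [3..<3 + (2 * n - 3)]"
      by (rule upt_add_eq_append) simp
    moreover have "[3..<(n + 1) + (n - 1)] = [3..<n + 1] @ [n + 1..<(n + 1) + (n - 1)]"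
      by (rule upt_add_eq_append) (use n in simp)
    moreover have "3 + (2 * n - 3) = 2 * n" "(n + 1) + (n - 1) = 2 * n"
      using n by simp_all
    moreover have "[0..<3] = [0, 1, 2 :: nat]"
      by (simp add: eval_nat_numeral)
    ultimately show ?thesis
      unfolding len by metis
  qed
  also have "map l \<dots> =
      [0, 2 * real n, 1] @ replicate (n - 2) (real n) @ replicate (n - 1) (real n + 1)"
  proof -
    have "map l [3..<n + 1] = map (\<lambda>_. real n) [3..<n + 1]"
      "map l [n + 1..<2 * n] = map (\<lambda>_. real n + 1) [n + 1..<2 * n]"
      using n by (auto simp: l_def)
    moreover have "n + 1 - 3 = n - 2" "2 * n - (n + 1) = n - 1"
      using n by simp_all
    ultimately show ?thesis
      by (simp only: map_append map_replicate_const length_upt) (simp add: l_def)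
  qed
  finally show ?thesis
    by simp
qed

lemma L_borderenergetic_G: "L_borderenergetic G"
proof -
  have "laplacian_energy G = real n + (real n - 1) + real n + real (n - 1)"
    using n by (simp add: laplacian_energy_def laplacian_spectrum_G average_degree_G)
  then show ?thesis
    using n by (simp add: L_borderenergetic_def card_verts of_nat_diff)
qed

end

lemma dot_complete_decompose:
  assumes "n \<ge> 3" "dot_complete n G"
  obtains U W v where "dot_complete_graph n G U W v"
proof -
  obtain H1 H2 v where "K\<^bsub>n\<^esub> (with_proj H1) \<and> K\<^bsub>n\<^esub> (with_proj H2) \<and>
      pverts H1 \<inter> pverts H2 = {} \<and> v \<in> pverts H1 \<and> pverts G = pverts H1 \<union> pverts H2 \<and>
      parcs G = parcs H1 \<union> parcs H2 \<union> {v} \<times> pverts H2 \<union> pverts H2 \<times> {v}"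
    using assms(2) unfolding dot_complete_def by (elim exE) (rule that)
  then have H: "finite (pverts H1)" "card (pverts H1) = n" "finite (pverts H2)" "card (pverts H2) = n"
      "pverts H1 \<inter> pverts H2 = {}" "v \<in> pverts H1" "pverts G = pverts H1 \<union> pverts H2"
    and arcs: "parcs G = {(x, y). x \<in> pverts H1 \<and> y \<in> pverts H1 \<and> x \<noteq> y} \<union>
      {(x, y). x \<in> pverts H2 \<and> y \<in> pverts H2 \<and> x \<noteq> y} \<union>
      {v} \<times> pverts H2 \<union> pverts H2 \<times> {v}"
    by (simp_all add: complete_digraph_pair_def)
  have "dot_complete_graph n G (pverts H1 - {v}) (pverts H2) v"
  proof
    show "(x, y) \<in> parcs G \<longleftrightarrow> x \<noteq> y \<and>
        (x \<in> pverts H1 - {v} \<and> y \<in> pverts H1 - {v} \<or> x \<in> pverts H2 \<and> y \<in> pverts H2 \<or>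
         x = v \<and> y \<in> (pverts H1 - {v}) \<union> pverts H2 \<or> y = v \<and> x \<in> (pverts H1 - {v}) \<union> pverts H2)"
      for x y
      using H(5,6) unfolding arcs by auto
  qed (use assms(1) H in auto)
  then show thesis ..
qed

theorem theorem4:
  fixes n :: nat and G :: "'a pair_pre_digraph" and H :: "'b pair_pre_digraph"
  assumes "n \<ge> 3"
    and "dot_complete n G"
    and "K\<^bsub>2 * n\<^esub> (with_proj H)"
  shows "pair_graph G \<and> card (pverts G) = 2 * n \<and> L_borderenergetic G \<and> L_noncospectral G H"
proof -
  obtain U W v where "dot_complete_graph n G U W v"
    using dot_complete_decompose[OF assms(1,2)] .
  then interpret dot_complete_graph n G U W v .
  have "1 \<in># laplacian_spectrum G"
    by (simp add: laplacian_spectrum_G)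
  moreover have "1 \<notin># laplacian_spectrum H"
    using assms(1) by (simp add: laplacian_spectrum_complete[OF assms(3)])
  ultimately show ?thesis
    using pair_graph_G card_verts L_borderenergetic_G by (auto simp: L_noncospectral_def)
qed

end
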